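(* For each of the following five graphs $G$ on the vertex set $\{v_1,v_2,v_3,v_4\}$, a triple $(x,y,z)\in\mathbb{R}^3$ is realizable by $G$ if and only if it satisfies the condition stated for that graph. (1) Star graph (A), with edges $v_1v_4,\ v_2v_4,\ v_3v_4$: $x,y,z\ge 0$ and $$(6x^{2}-2xy-2xz+yz)(6y^2-2xy-2yz+xz)(6z^2-2xz-2yz+xy)\le 0.$$ (2) Cycle graph (B), with edges $v_1v_2,\ v_2v_3,\ v_3v_4,\ v_4v_1$: $x,y,z\ge 0$ and $$\max\{x,y,z\}\ge \tfrac12 (x+y+z).$$ (3) Path graph (C), with edges $v_1v_2,\ v_2v_3,\ v_3v_4$: $x,y,z\ge 0$, $\max\{x,y,z\}\ge \tfrac12(x+y+z)$, and $$\Big(9(x^3+y^3+z^3)-13U+62xyz\Big)^2\le (3S-2P)^2(9S-14P),$$ where $S=x^2+y^2+z^2$, $P=xy+xz+yz$, and $U=x^2(y+z)+y^2(x+z)+z^2(x+y)$. (4) Kite graph (D), with edges $v_1v_2,\ v_2v_3,\ v_1v_3,\ v_3v_4$: $x,y,z\ge 0$ and at least one of the following inequalities holds: $$\sqrt3\,|x-y|\ge x+y,\qquad \sqrt3\,|x-z|\ge x+z,\qquad \sqrt3\,|y-z|\ge y+z.$$ (5) Complete graph $K_4$ (E), with all six edges $v_iv_j$, $1\le i<j\le 4$: $x,y,z\ge 0$.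
   Context: Let $G$ be a finite simple graph with vertices $v_1,\dots,v_n$. A weight function assigns to each edge $v_iv_j$ of $G$ a real number $w_{ij}=w_{ji}\ge 0$; zero weights are allowed (a zero weight amounts to deleting the edge). Put $w_{ij}=0$ if $v_iv_j$ is not an edge. The weighted graph Laplacian is the symmetric $n\times n$ matrix $L$ with $L_{ij}=-w_{ij}$ for $i\ne j$ and $L_{ii}=\sum_{j\ne i}w_{ij}$ (weighted degree matrix minus weighted adjacency matrix). It is positive semidefinite and always has $0$ as an eigenvalue, with eigenvector $(1,\dots,1)$. For a graph $G$ on four vertices, a triple $(x,y,z)$ of real numbers is called realizable by $G$ if there is a nonnegative weight function on the edges of $G$ such that the eigenvalues of $L$, counted with multiplicity, are $0,x,y,z$. The eigenvalues are not ordered, so any permutation of a realizable triple is realizable, and some of $x,y,z$ may be $0$. *)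

theory Defs
  imports "Jordan_Normal_Form.Char_Poly"
begin

text \<open>
  A simple graph on the vertices $v_1,\dots,v_n$ is given by its set of edges, an edge
  $v_i v_j$ being the unordered pair \<open>{i, j}\<close> of its indices.
\<close>

definition simple_graph :: "nat \<Rightarrow> nat set set \<Rightarrow> bool" where
  "simple_graph n E \<longleftrightarrow> E \<subseteq> {e. e \<subseteq> {1..n} \<and> card e = 2}"

text \<open>
  \<open>w i j\<close> is the weight $w_{ij}$, extended by zero to all pairs that are not edges
  (in particular \<open>w i i = 0\<close>, as singletons are not edges).
\<close>

definition weight_function :: "nat set set \<Rightarrow> (nat \<Rightarrow> nat \<Rightarrow> real) \<Rightarrow> bool" where
  "weight_function E w \<longleftrightarrow>
     (\<forall>i j. w i j = w j i) \<and>
     (\<forall>i j. w i j \<ge> 0) \<and>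
     (\<forall>i j. {i, j} \<notin> E \<longrightarrow> w i j = 0)"

text \<open>
  Matrix indices start at 0 and vertex indices at 1, so row (column) \<open>i\<close> belongs to
  vertex \<open>Suc i\<close>.
\<close>

definition weighted_laplacian :: "nat \<Rightarrow> (nat \<Rightarrow> nat \<Rightarrow> real) \<Rightarrow> real mat" where
  "weighted_laplacian n w = mat n n (\<lambda>(i, j).
     if i = j then \<Sum>k\<in>{1..n} - {Suc i}. w (Suc i) k else - w (Suc i) (Suc j))"

text \<open>
  \<open>proots (char_poly L)\<close> is the multiset of real eigenvalues of \<open>L\<close>. Equality with a
  multiset of size 4 says that these are all eigenvalues, since the characteristic
  polynomial has degree 4.
\<close>

definition realizable :: "nat set set \<Rightarrow> real \<times> real \<times> real \<Rightarrow> bool" where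
  "realizable E = (\<lambda>(x, y, z).
     \<exists>w. weight_function E w \<and>
         proots (char_poly (weighted_laplacian 4 w)) = {#0, x, y, z#})"

definition star_graph :: "nat set set" where
  "star_graph = {{1, 4}, {2, 4}, {3, 4}}"

definition cycle_graph :: "nat set set" where
  "cycle_graph = {{1, 2}, {2, 3}, {3, 4}, {4, 1}}"

definition path_graph :: "nat set set" where
  "path_graph = {{1, 2}, {2, 3}, {3, 4}}"

definition kite_graph :: "nat set set" where
  "kite_graph = {{1, 2}, {2, 3}, {1, 3}, {3, 4}}"

definition complete_graph :: "nat set set" where
  "complete_graph = {{i, j} | i j. 1 \<le> i \<and> i < j \<and> j \<le> 4}"

lemma simple_graphs:
  "simple_graph 4 star_graph" "simple_graph 4 cycle_graph" "simple_graph 4 path_graph"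
  "simple_graph 4 kite_graph" "simple_graph 4 complete_graph"
  unfolding simple_graph_def star_graph_def cycle_graph_def path_graph_def kite_graph_def
    complete_graph_def
  by auto

end

theory Submission
  imports Defs
begin

text \<open>
  Comparing coefficients of the characteristic polynomial turns realizability into three
  polynomial equations between the weights and the elementary symmetric functions
  \<open>e1, e2, e3\<close> of \<open>x, y, z\<close>.
  For the star these are Vieta's formulas for the cubic \<open>t^3 - e1/2 t^2 + e2/3 t - e3/4\<close>, so the
  condition is that its discriminant is nonnegative.
  For the cycle, the product of the \<open>e1 - 2 \<lambda>\<close> over the three eigenvalues is minus a sum of
  nonnegative terms in the weights; conversely two equal opposite weights suffice.
  For the path, the middle weight solves a cubic equation and a quadratic inequality, whose joint
  solvability is decided by a resultant.
  For the kite, Cauchy interlacing with a two-dimensional compression bounds the quotient of the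
  extreme eigenvalues; conversely two equal weights in the triangle suffice.
\<close>

subsection \<open>Weights and elementary symmetric functions\<close>

lemma monic_eq_prod_proots:
  fixes p :: "'a :: idom poly"
  assumes "lead_coeff p = 1" "size (proots p) = degree p"
  shows "p = (\<Prod>x\<in>#proots p. [:-x, 1:])"
  using assms
proof (induction "degree p" arbitrary: p)
  case 0
  then show ?case by (auto elim!: degree_eq_zeroE)
next
  case (Suc n)
  have p0: "p \<noteq> 0" using Suc.prems(1) by auto
  from Suc have "proots p \<noteq> {#}" by auto
  then obtain x where x: "x \<in># proots p" by blast
  hence "poly p x = 0" using p0 by simp
  then obtain q where q: "p = [:-x, 1:] * q" by (auto simp: poly_eq_0_iff_dvd)
  have q0: "q \<noteq> 0" using p0 q by auto
  have dq: "degree p = Suc (degree q)" unfolding q using q0 by (subst degree_mult_eq) auto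
  have pr: "proots p = add_mset x (proots q)" unfolding q using q0 by (subst proots_mult) auto
  have "lead_coeff q = 1" using Suc.prems(1) unfolding q lead_coeff_mult by simp
  then have "q = (\<Prod>x\<in>#proots q. [:-x, 1:])"
    using Suc dq pr by auto
  then show ?case using q pr by simp
qed

text \<open>Once the number of roots equals the degree, the polynomial splits into linear factors.
  This replaces an equation between multisets of eigenvalues by a polynomial identity.\<close>

lemma proots_eq_iff_monic:
  fixes p :: "'a :: idom poly"
  assumes "lead_coeff p = 1" "degree p = size M"
  shows "proots p = M \<longleftrightarrow> p = (\<Prod>x\<in>#M. [:-x, 1:])"
proof
  assume "p = (\<Prod>x\<in>#M. [:-x, 1:])"
  moreover have "proots (\<Prod>x\<in>#M. [:-x, 1:]) = M"
  proof (induction M)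
    case (add x M)
    have "(\<Prod>x\<in>#M. [:-x, 1:]) \<noteq> 0" by auto
    then show ?case using add by (simp add: proots_mult del: mult_pCons_left)
  qed simp
  ultimately show "proots p = M" by simp
qed (use assms monic_eq_prod_proots[of p] in auto)

section \<open>The characteristic polynomial of the Laplacian\<close>

lemma det_mat_Suc:
  fixes f :: "nat \<times> nat \<Rightarrow> 'a :: comm_ring_1"
  shows "det (mat (Suc n) (Suc n) f) =
    (\<Sum>j<Suc n. f (0, j) * (-1) ^ j *
      det (mat n n (\<lambda>(i, k). f (Suc i, if k < j then k else Suc k))))"
proof -
  have "mat_delete (mat (Suc n) (Suc n) f) 0 j =
      mat n n (\<lambda>(i, k). f (Suc i, if k < j then k else Suc k))"
    if "j < Suc n" for j
    using that by (intro eq_matI) (auto simp: mat_delete_def)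
  then show ?thesis
    by (subst laplace_expansion_row[of _ "Suc n" 0])
       (auto simp: cofactor_def mult.assoc intro!: sum.cong)
qed

text \<open>Evaluating first keeps the determinant over the base ring instead of over
  polynomials.\<close>

lemma poly_char_poly_mat:
  "poly (char_poly (mat n n f)) t = det (mat n n (\<lambda>(i, j). (if i = j then t else 0) - f (i, j)))"
  unfolding char_poly_def
  by (rule poly_det_cong[of _ n]) (auto simp: char_poly_matrix_def)

lemma det_mat_4:
  fixes f :: "nat \<times> nat \<Rightarrow> 'a :: comm_ring_1"
  shows "det (mat 4 4 f) =
    f (0, 0) * (f (1, 1) * (f (2, 2) * f (3, 3) - f (2, 3) * f (3, 2))
      - f (1, 2) * (f (2, 1) * f (3, 3) - f (2, 3) * f (3, 1))
      + f (1, 3) * (f (2, 1) * f (3, 2) - f (2, 2) * f (3, 1)))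
    - f (0, 1) * (f (1, 0) * (f (2, 2) * f (3, 3) - f (2, 3) * f (3, 2))
      - f (1, 2) * (f (2, 0) * f (3, 3) - f (2, 3) * f (3, 0))
      + f (1, 3) * (f (2, 0) * f (3, 2) - f (2, 2) * f (3, 0)))
    + f (0, 2) * (f (1, 0) * (f (2, 1) * f (3, 3) - f (2, 3) * f (3, 1))
      - f (1, 1) * (f (2, 0) * f (3, 3) - f (2, 3) * f (3, 0))
      + f (1, 3) * (f (2, 0) * f (3, 1) - f (2, 1) * f (3, 0)))
    - f (0, 3) * (f (1, 0) * (f (2, 1) * f (3, 2) - f (2, 2) * f (3, 1))
      - f (1, 1) * (f (2, 0) * f (3, 2) - f (2, 2) * f (3, 0))
      + f (1, 2) * (f (2, 0) * f (3, 1) - f (2, 1) * f (3, 0)))"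
proof -
  have 1: "det (mat (Suc 0) (Suc 0) g) = g (0, 0)" for g :: "nat \<times> nat \<Rightarrow> 'a"
    unfolding det_mat_Suc[of 0] by simp
  have 2: "det (mat (Suc (Suc 0)) (Suc (Suc 0)) g) =
    g (0, 0) * g (Suc 0, Suc 0) - g (0, Suc 0) * g (Suc 0, 0)" for g :: "nat \<times> nat \<Rightarrow> 'a"
    unfolding det_mat_Suc[of "Suc 0"] 1 by simp
  have 3: "det (mat (Suc (Suc (Suc 0))) (Suc (Suc (Suc 0))) g) =
    g (0, 0) * (g (Suc 0, Suc 0) * g (Suc (Suc 0), Suc (Suc 0))
      - g (Suc 0, Suc (Suc 0)) * g (Suc (Suc 0), Suc 0))
    - g (0, Suc 0) * (g (Suc 0, 0) * g (Suc (Suc 0), Suc (Suc 0))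
      - g (Suc 0, Suc (Suc 0)) * g (Suc (Suc 0), 0))
    + g (0, Suc (Suc 0)) * (g (Suc 0, 0) * g (Suc (Suc 0), Suc 0)
      - g (Suc 0, Suc 0) * g (Suc (Suc 0), 0))"
    for g :: "nat \<times> nat \<Rightarrow> 'a"
    unfolding det_mat_Suc[of "Suc (Suc 0)"] 2 by (simp add: lessThan_Suc)
  have 4: "4 = Suc (Suc (Suc (Suc 0)))" by simp
  show ?thesis
    unfolding 4 det_mat_Suc[of "Suc (Suc (Suc 0))"] 3
    by (simp add: lessThan_Suc numeral_2_eq_2 numeral_3_eq_3)
qed

lemma laplacian_char_poly:
  assumes sym: "\<And>i j. w i j = w j i"
  defines "a \<equiv> w 1 2" and "b \<equiv> w 1 3" and "c \<equiv> w 1 4"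
    and "d \<equiv> w 2 3" and "e \<equiv> w 2 4" and "f \<equiv> w 3 4"
  shows "poly (char_poly (weighted_laplacian 4 w)) t = t * (t ^ 3
    - 2 * (a + b + c + d + e + f) * t\<^sup>2
    + (3 * (a*b + a*c + a*d + a*e + b*c + b*d + b*f + c*e + c*f + d*e + d*f + e*f)
        + 4 * (a*f + b*e + c*d)) * t
    - 4 * (a*b*c + a*b*e + a*b*f + a*c*d + a*c*f + a*d*e + a*d*f + a*e*f
        + b*c*d + b*c*e + b*d*e + b*d*f + b*e*f + c*d*e + c*d*f + c*e*f))"
proof -
  have sets: "{1..4} - {Suc 0} = {2, 3, 4}" "{1..4} - {2} = {1, 3, 4 :: nat}"
    "{1..4} - {3} = {1, 2, 4 :: nat}" "{1..4} - {4} = {1, 2, 3 :: nat}" by auto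
  note w = sym[of 2 1] sym[of 3 1] sym[of 4 1] sym[of 3 2] sym[of 4 2] sym[of 4 3]
  show ?thesis
    unfolding weighted_laplacian_def poly_char_poly_mat det_mat_4
    using w by (simp add: assms sets[unfolded One_nat_def] flip: numeral_2_eq_2)
      Groebner_Basis.algebra \<comment> \<open>HOL-Algebra shadows the unqualified method name \<open>algebra\<close>.\<close>
qed

text \<open>
  The weights \<open>a, b, c, d, e, f\<close> belong to the edges 12, 13, 14, 23, 24, 34. A spanning forest
  contributes the product of its component sizes: \<open>3\<close> for two adjacent edges, \<open>4\<close> for two
  opposite edges, and \<open>4\<close> for each of the 16 spanning trees.
\<close>
definition laplacian_coeffs ::
  "real \<Rightarrow> real \<Rightarrow> real \<Rightarrow> real \<Rightarrow> real \<Rightarrow> real \<Rightarrow> real \<Rightarrow> real \<Rightarrow> real \<Rightarrow> bool" where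
  "laplacian_coeffs a b c d e f x y z \<longleftrightarrow>
    x + y + z = 2 * (a + b + c + d + e + f) \<and>
    x * y + x * z + y * z =
      3 * (a*b + a*c + a*d + a*e + b*c + b*d + b*f + c*e + c*f + d*e + d*f + e*f)
        + 4 * (a*f + b*e + c*d) \<and>
    x * y * z = 4 * (a*b*c + a*b*e + a*b*f + a*c*d + a*c*f + a*d*e + a*d*f + a*e*f
        + b*c*d + b*c*e + b*d*e + b*d*f + b*e*f + c*d*e + c*d*f + c*e*f)"

lemma vieta_cubic:
  fixes p q r x y z :: real
  shows "(\<forall>t. t * (t ^ 3 - p * t\<^sup>2 + q * t - r) = t * (t - x) * (t - y) * (t - z)) \<longleftrightarrow>
    x + y + z = p \<and> x * y + x * z + y * z = q \<and> x * y * z = r"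
proof
  assume *: "\<forall>t. t * (t ^ 3 - p * t\<^sup>2 + q * t - r) = t * (t - x) * (t - y) * (t - z)"
  \<comment> \<open>After cancelling \<open>t\<close>, two monic cubics differ by a polynomial of
    degree at most 2, so agreement at three nonzero points suffices.\<close>
  show "x + y + z = p \<and> x * y + x * z + y * z = q \<and> x * y * z = r"
    using *[rule_format, of 1] *[rule_format, of "-1"] *[rule_format, of 2]
    by (simp add: algebra_simps)
next
  assume "x + y + z = p \<and> x * y + x * z + y * z = q \<and> x * y * z = r"
  then show "\<forall>t. t * (t ^ 3 - p * t\<^sup>2 + q * t - r) = t * (t - x) * (t - y) * (t - z)"
    by (auto simp: algebra_simps power2_eq_square power3_eq_cube)
qed

lemma proots_laplacian_iff:
  assumes sym: "\<And>i j. w i j = w j i"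
  shows "proots (char_poly (weighted_laplacian 4 w)) = {#0, x, y, z#} \<longleftrightarrow>
    laplacian_coeffs (w 1 2) (w 1 3) (w 1 4) (w 2 3) (w 2 4) (w 3 4) x y z"
proof -
  let ?p = "char_poly (weighted_laplacian 4 w)"
  have "weighted_laplacian 4 w \<in> carrier_mat 4 4" by (simp add: weighted_laplacian_def)
  from degree_monic_char_poly[OF this] have "degree ?p = 4" "lead_coeff ?p = 1" by auto
  then have "proots ?p = {#0, x, y, z#} \<longleftrightarrow> ?p = (\<Prod>x\<in>#{#0, x, y, z#}. [:-x, 1:])"
    by (intro proots_eq_iff_monic) auto
  also have "\<dots> \<longleftrightarrow> (\<forall>t. poly ?p t = t * (t - x) * (t - y) * (t - z))"
    by (subst poly_eq_poly_eq_iff[symmetric]) (auto simp: fun_eq_iff algebra_simps)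
  also have "\<dots> \<longleftrightarrow> laplacian_coeffs (w 1 2) (w 1 3) (w 1 4) (w 2 3) (w 2 4) (w 3 4) x y z"
    unfolding laplacian_char_poly[OF sym] vieta_cubic laplacian_coeffs_def ..
  finally show ?thesis .
qed

section \<open>Realizability in terms of the six edge weights\<close>

lemma realizableE:
  assumes "realizable E (x, y, z)"
  obtains a b c d e f where "laplacian_coeffs a b c d e f x y z"
    "a \<ge> 0" "b \<ge> 0" "c \<ge> 0" "d \<ge> 0" "e \<ge> 0" "f \<ge> 0"
    "{1, 2} \<notin> E \<Longrightarrow> a = 0" "{1, 3} \<notin> E \<Longrightarrow> b = 0" "{1, 4} \<notin> E \<Longrightarrow> c = 0"
    "{2, 3} \<notin> E \<Longrightarrow> d = 0" "{2, 4} \<notin> E \<Longrightarrow> e = 0" "{3, 4} \<notin> E \<Longrightarrow> f = 0"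
proof -
  from assms obtain w where w: "weight_function E w"
    and roots: "proots (char_poly (weighted_laplacian 4 w)) = {#0, x, y, z#}"
    by (auto simp: realizable_def)
  have sym: "w i j = w j i" and props: "w i j \<ge> 0" "{i, j} \<notin> E \<Longrightarrow> w i j = 0" for i j
    using w by (simp_all add: weight_function_def)
  from roots have "laplacian_coeffs (w 1 2) (w 1 3) (w 1 4) (w 2 3) (w 2 4) (w 3 4) x y z"
    by (simp only: proots_laplacian_iff[OF sym])
  then show thesis by (rule that) (auto intro: props)
qed

lemma realizableI:
  assumes coeffs: "laplacian_coeffs a b c d e f x y z"
    and nonneg: "a \<ge> 0" "b \<ge> 0" "c \<ge> 0" "d \<ge> 0" "e \<ge> 0" "f \<ge> 0"
    and supp: "{1, 2} \<notin> E \<Longrightarrow> a = 0" "{1, 3} \<notin> E \<Longrightarrow> b = 0" "{1, 4} \<notin> E \<Longrightarrow> c = 0"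
      "{2, 3} \<notin> E \<Longrightarrow> d = 0" "{2, 4} \<notin> E \<Longrightarrow> e = 0" "{3, 4} \<notin> E \<Longrightarrow> f = 0"
  shows "realizable E (x, y, z)"
proof -
  \<comment> \<open>Weights placed on unordered pairs make symmetry automatic.\<close>
  define W where "W A = (if A = {1, 2} then a else if A = {1, 3} then b
    else if A = {1, 4} then c else if A = {2, 3} then d
    else if A = {2, 4} then e else if A = {3, 4} then f else 0)" for A :: "nat set"
  define w where "w i j = W {i, j}" for i j
  have sym: "w i j = w j i" for i j by (simp add: w_def insert_commute)
  have "w 1 2 = a" "w 1 3 = b" "w 1 4 = c" "w 2 3 = d" "w 2 4 = e" "w 3 4 = f"
    by (simp_all add: w_def W_def doubleton_eq_iff)
  with coeffs have "proots (char_poly (weighted_laplacian 4 w)) = {#0, x, y, z#}"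
    by (simp only: proots_laplacian_iff[OF sym])
  moreover have "w i j \<ge> 0" for i j
    using nonneg by (simp add: w_def W_def)
  moreover have "W A = 0" if "A \<notin> E" for A
  proof -
    have if_zero: "(if P then r else s) = 0" if "P \<Longrightarrow> r = 0" "s = 0" for P and r s :: real
      using that by simp
    show ?thesis
      unfolding W_def by (intro if_zero) (use that supp in simp_all)
  qed
  then have "w i j = 0" if "{i, j} \<notin> E" for i j
    using that by (simp add: w_def)
  ultimately show ?thesis
    unfolding realizable_def weight_function_def using sym by blast
qed

lemma realizable_swap12: "realizable E (x, y, z) \<longleftrightarrow> realizable E (y, x, z)"
  and realizable_swap23: "realizable E (x, y, z) \<longleftrightarrow> realizable E (x, z, y)"
  by (simp_all add: realizable_def add_mset_commute)

lemma sorted_triple_wlog: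
  fixes x y z :: "'a :: linorder"
  assumes "\<And>x y z. P x y z \<Longrightarrow> P y x z" "\<And>x y z. P x y z \<Longrightarrow> P x z y"
    and "\<And>x y z. x \<le> y \<Longrightarrow> y \<le> z \<Longrightarrow> P x y z"
  shows "P x y z"
  using assms by (metis linear)

text \<open>At a negative number each term of the cubic with roots \<open>x\<close>,
  \<open>y\<close>, \<open>z\<close> is nonpositive and the leading one is negative, so no root is
  negative.\<close>

lemma nonneg_if_elementary_symmetric_nonneg:
  fixes x y z :: "'a :: linordered_idom"
  assumes "x + y + z \<ge> 0" "x * y + x * z + y * z \<ge> 0" "x * y * z \<ge> 0"
  shows "x \<ge> 0"
proof (rule ccontr)
  assume x: "\<not> x \<ge> 0"
  have "x ^ 3 - (x + y + z) * x\<^sup>2 + (x * y + x * z + y * z) * x - x * y * z = 0"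
    by Groebner_Basis.algebra
  moreover have "x ^ 3 < 0" using x by (simp add: power_less_zero_eq)
  moreover have "(x + y + z) * x\<^sup>2 \<ge> 0" using assms by simp
  moreover have "(x * y + x * z + y * z) * x \<le> 0" using assms x by (simp add: mult_nonneg_nonpos)
  ultimately show False using assms by linarith
qed

lemma laplacian_coeffs_nonneg:
  assumes "laplacian_coeffs a b c d e f x y z"
    and "a \<ge> 0" "b \<ge> 0" "c \<ge> 0" "d \<ge> 0" "e \<ge> 0" "f \<ge> 0"
  shows "x \<ge> 0" "y \<ge> 0" "z \<ge> 0"
proof -
  have 1: "x + y + z \<ge> 0" and 2: "x * y + x * z + y * z \<ge> 0" and 3: "x * y * z \<ge> 0"
    using assms unfolding laplacian_coeffs_def by simp_all
  show "x \<ge> 0" by (rule nonneg_if_elementary_symmetric_nonneg[OF 1 2 3])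
  show "y \<ge> 0"
    by (rule nonneg_if_elementary_symmetric_nonneg[of y x z])
       (use 1 2 3 in \<open>simp_all add: ac_simps\<close>)
  show "z \<ge> 0"
    by (rule nonneg_if_elementary_symmetric_nonneg[of z x y])
       (use 1 2 3 in \<open>simp_all add: ac_simps\<close>)
qed

lemma nonneg_quadratic_roots:
  fixes p m :: real
  assumes "p \<ge> 0" "m \<ge> 0" "4 * m \<le> p\<^sup>2"
  obtains u v where "0 \<le> u" "u \<le> v" "u + v = p" "u * v = m"
proof
  let ?r = "sqrt (p\<^sup>2 - 4 * m)"
  have sq: "?r\<^sup>2 = p\<^sup>2 - 4 * m" using assms by simp
  have "?r \<le> sqrt (p\<^sup>2)" using assms by (intro real_sqrt_le_mono) simp
  with assms show "0 \<le> (p - ?r) / 2" by simp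
  show "(p - ?r) / 2 \<le> (p + ?r) / 2" using assms by simp
  show "(p - ?r) / 2 + (p + ?r) / 2 = p" by (simp add: field_simps)
  have "(p - ?r) / 2 * ((p + ?r) / 2) = (p\<^sup>2 - ?r\<^sup>2) / 4"
    by (simp add: field_simps power2_eq_square)
  with sq show "(p - ?r) / 2 * ((p + ?r) / 2) = m" by simp
qed

subsection \<open>Star\<close>

lemma cubic_discriminant_roots:
  fixes a b c :: "'a :: idom"
  assumes "p = a + b + c" "q = a * b + a * c + b * c" "r = a * b * c"
  shows "p\<^sup>2 * q\<^sup>2 - 4 * q ^ 3 - 4 * p ^ 3 * r + 18 * p * q * r - 27 * r\<^sup>2 =
    ((a - b) * (a - c) * (b - c))\<^sup>2"
  unfolding assms by Groebner_Basis.algebra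

lemma nonneg_cubic_roots:
  fixes p q r :: real
  assumes "p \<ge> 0" "q \<ge> 0" "r \<ge> 0"
    and disc: "p\<^sup>2 * q\<^sup>2 - 4 * q ^ 3 - 4 * p ^ 3 * r + 18 * p * q * r - 27 * r\<^sup>2 \<ge> 0"
  obtains a b c where "a \<ge> 0" "b \<ge> 0" "c \<ge> 0"
    "a + b + c = p" "a * b + a * c + b * c = q" "a * b * c = r"
proof -
  define g where "g t = t ^ 3 - p * t\<^sup>2 + q * t - r" for t
  \<comment> \<open>\<open>M\<close> is chosen so that \<open>M^3 - p * M^2 = M^2 * (r + 1)\<close>,
    which outweighs \<open>r\<close>; since \<open>g 0 = - r\<close>, a root lies between
    \<open>0\<close> and \<open>M\<close>.\<close>
  define M where "M = p + r + 1"
  have "1 \<le> M\<^sup>2" using assms by (simp add: M_def)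
  then have "r + 1 \<le> M\<^sup>2 * (r + 1)" using assms mult_right_mono[of 1 "M\<^sup>2" "r + 1"] by simp
  moreover have "g M = M\<^sup>2 * (r + 1) + q * M - r" by (simp add: g_def M_def) Groebner_Basis.algebra
  moreover have "q * M \<ge> 0" using assms by (simp add: M_def)
  ultimately have "0 \<le> g M" by linarith
  then have "\<exists>t\<ge>0. t \<le> M \<and> g t = 0"
    using assms by (intro IVT') (auto simp: g_def M_def intro!: continuous_intros)
  then obtain a where a: "g a = 0" by auto
  \<comment> \<open>\<open>t^2 - s t + m\<close> is the quotient of the cubic by
    \<open>t - a\<close>.\<close>
  define s m where "s = p - a" and "m = q - a * s"
  have r: "r = a * m" using a unfolding g_def m_def s_def by Groebner_Basis.algebra
  have "p\<^sup>2 * q\<^sup>2 - 4 * q ^ 3 - 4 * p ^ 3 * r + 18 * p * q * r - 27 * r\<^sup>2 =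
    (s\<^sup>2 - 4 * m) * (a\<^sup>2 - s * a + m)\<^sup>2"
  proof -
    have "p = a + s" "q = m + a * s" by (simp_all add: s_def m_def)
    with r show ?thesis by Groebner_Basis.algebra
  qed
  then have "s\<^sup>2 - 4 * m \<ge> 0 \<or> a\<^sup>2 - s * a + m = 0"
    using disc by (metis mult_neg_pos not_less zero_less_power2)
  \<comment> \<open>Here \<open>a\<close> is also a root of the quotient, which therefore splits
    over the reals.\<close>
  moreover have "s\<^sup>2 - 4 * m \<ge> 0" if "a\<^sup>2 - s * a + m = 0"
  proof -
    have "s\<^sup>2 - 4 * m = (s - 2 * a)\<^sup>2" using that by Groebner_Basis.algebra
    then show ?thesis by simp
  qed
  ultimately have D: "s\<^sup>2 - 4 * m \<ge> 0" by blast
  define b c where "b = (s + sqrt (s\<^sup>2 - 4 * m)) / 2" and "c = (s - sqrt (s\<^sup>2 - 4 * m)) / 2"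
  have bc: "b + c = s" "b * c = m"
    using D real_sqrt_pow2[OF D] by (simp_all add: b_def c_def field_simps power2_eq_square)
  have abc: "a + b + c = p" "a * b + a * c + b * c = q" "a * b * c = r"
    using bc r unfolding s_def m_def by Groebner_Basis.algebra+
  show thesis
  proof
    show "a \<ge> 0"
      by (rule nonneg_if_elementary_symmetric_nonneg[of a b c]) (use abc assms in simp_all)
    show "b \<ge> 0"
      by (rule nonneg_if_elementary_symmetric_nonneg[of b a c])
         (use abc assms in \<open>simp_all add: ac_simps\<close>)
    show "c \<ge> 0"
      by (rule nonneg_if_elementary_symmetric_nonneg[of c a b])
         (use abc assms in \<open>simp_all add: ac_simps\<close>)
  qed (fact abc)+
qed

subsection \<open>Cycle\<close>

text \<open>Any two factors add up to twice one of \<open>x\<close>, \<open>y\<close>,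
  \<open>z\<close>, so a nonpositive factor forces the other two to be nonnegative.\<close>

lemma max_ge_half_sum_iff:
  fixes x y z :: real
  assumes "x \<ge> 0" "y \<ge> 0" "z \<ge> 0"
  shows "Max {x, y, z} \<ge> 1 / 2 * (x + y + z) \<longleftrightarrow> (y + z - x) * (x + z - y) * (x + y - z) \<le> 0"
proof -
  have "Max {x, y, z} \<ge> 1 / 2 * (x + y + z) \<longleftrightarrow> y + z - x \<le> 0 \<or> x + z - y \<le> 0 \<or> x + y - z \<le> 0"
    by (auto simp: max_def)
  also have "\<dots> \<longleftrightarrow> (y + z - x) * (x + z - y) * (x + y - z) \<le> 0" (is "?L \<longleftrightarrow> ?R")
  proof
    assume ?R
    then show ?L by (meson mult_pos_pos not_less)
  next
    assume ?L
    then consider "y + z - x \<le> 0" | "x + z - y \<le> 0" | "x + y - z \<le> 0" by blast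
    then show ?R
      by cases (use assms in \<open>simp_all add: mult_le_0_iff zero_le_mult_iff\<close>)
  qed
  finally show ?thesis .
qed

lemma cycle_identity:
  fixes x y z :: real
  assumes "laplacian_coeffs a 0 c d 0 f x y z"
  shows "(y + z - x) * (x + z - y) * (x + y - z) =
    - 8 * ((a + f) * (a - f)\<^sup>2 + (c + d) * (c - d)\<^sup>2)"
proof -
  have "x + y + z = 2 * (a + c + d + f)" "x * y + x * z + y * z =
      3 * (a*c + a*d + c*f + d*f) + 4 * (a*f + c*d)"
      "x * y * z = 4 * (a*c*d + a*c*f + a*d*f + c*d*f)"
    using assms by (simp_all add: laplacian_coeffs_def)
  then show ?thesis by Groebner_Basis.algebra
qed

text \<open>This serves the path as well, as the cycle whose edge 14 has weight zero.\<close>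

lemma cycle_max_condition:
  fixes x y z :: real
  assumes "laplacian_coeffs a 0 c d 0 f x y z" and "a \<ge> 0" "c \<ge> 0" "d \<ge> 0" "f \<ge> 0"
  shows "Max {x, y, z} \<ge> 1 / 2 * (x + y + z)"
proof -
  define k where "k = (a + f) * (a - f)\<^sup>2 + (c + d) * (c - d)\<^sup>2"
  have "k \<ge> 0" unfolding k_def using assms by simp
  then have "(y + z - x) * (x + z - y) * (x + y - z) \<le> 0"
    using cycle_identity[OF assms(1), folded k_def] by linarith
  moreover have "x \<ge> 0" "y \<ge> 0" "z \<ge> 0"
    using laplacian_coeffs_nonneg[OF assms(1)] assms by simp_all
  ultimately show ?thesis by (simp only: max_ge_half_sum_iff)
qed

text \<open>
  If both edges 23 and 14 get weight \<open>x / 2\<close>, then \<open>(1, 1, -1, -1)\<close> is an eigenvector for \<open>x\<close>, and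
  \<open>y, z\<close> determine the sum \<open>p\<close> and the product \<open>m\<close> of the other two weights.
\<close>
lemma realizable_cycle_sorted:
  assumes "0 \<le> x" "x \<le> y" "x + y \<le> z"
  shows "realizable cycle_graph (x, y, z)"
proof -
  define p m where "p = (y + z - x) / 2" and "m = (2 * (y * z) - x * y - x * z + x\<^sup>2) / 8"
  have "8 * m = y * z + (y - x) * (z - x)"
  proof -
    have "8 * m = 2 * (y * z) - x * y - x * z + x\<^sup>2" by (simp add: m_def)
    then show ?thesis by Groebner_Basis.algebra
  qed
  moreover have "y * z \<ge> 0" "(y - x) * (z - x) \<ge> 0" using assms by simp_all
  ultimately have "m \<ge> 0" by linarith
  \<comment> \<open>The last factor is where \<open>x + y \<le> z\<close> enters.\<close>
  moreover have "4 * (p\<^sup>2 - 4 * m) = (z - y + x) * (z - y - x)"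
    by (simp add: p_def m_def field_simps power2_eq_square)
  then have "4 * (p\<^sup>2 - 4 * m) \<ge> 0" using assms by simp
  then have "4 * m \<le> p\<^sup>2" by simp
  moreover have "p \<ge> 0" using assms by (simp add: p_def)
  ultimately obtain a f where af: "0 \<le> a" "a \<le> f" "a + f = p" "a * f = m"
    using nonneg_quadratic_roots by blast
  have af': "y + z = 2 * (a + f) + x" "8 * (a * f) = 2 * (y * z) - x * y - x * z + x\<^sup>2"
    using af by (simp_all add: p_def m_def)
  have "laplacian_coeffs a 0 (x/2) (x/2) 0 f x y z"
  proof -
    obtain v where "x = 2 * v" by (metis mult_2_right field_sum_of_halves mult_2)
    with af' show ?thesis
      unfolding laplacian_coeffs_def by (intro conjI; simp; Groebner_Basis.algebra)
  qed
  then show ?thesis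
    by (rule realizableI) (use af assms in \<open>auto simp: cycle_graph_def\<close>)
qed

subsection \<open>Kite\<close>

text \<open>The constant arises as \<open>(sqrt 3 + 1) / (sqrt 3 - 1) = 2 + sqrt 3\<close>.\<close>

lemma sqrt3_ratio_iff:
  fixes x z :: real
  assumes "x \<le> z"
  shows "sqrt 3 * \<bar>x - z\<bar> \<ge> x + z \<longleftrightarrow> (2 + sqrt 3) * x \<le> z"
proof -
  have "sqrt 3 > (1 :: real)" by simp
  have factor: "(k - 1) * z - (k + 1) * x = (k - 1) * (z - (2 + k) * x)"
    if "k * k = 3" for k :: real
  proof -
    have "k * (k * x) = 3 * x" using that by (metis mult.assoc)
    then show ?thesis by (simp add: algebra_simps power2_eq_square)
  qed
  have "sqrt 3 * \<bar>x - z\<bar> \<ge> x + z \<longleftrightarrow> (sqrt 3 - 1) * z - (sqrt 3 + 1) * x \<ge> 0"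
    using assms by (simp add: algebra_simps)
  also have "(sqrt 3 - 1) * z - (sqrt 3 + 1) * x = (sqrt 3 - 1) * (z - (2 + sqrt 3) * x)"
    by (rule factor) simp
  also have "\<dots> \<ge> 0 \<longleftrightarrow> (2 + sqrt 3) * x \<le> z"
    using \<open>sqrt 3 > 1\<close> by (simp add: zero_le_mult_iff)
  finally show ?thesis .
qed

text \<open>Among the three pairs, the smallest and largest entries have the most extreme
  ratio.\<close>

lemma kite_condition_sorted:
  fixes x y z :: real
  assumes "0 \<le> x" "x \<le> y" "y \<le> z"
  shows "sqrt 3 * \<bar>x - y\<bar> \<ge> x + y \<or> sqrt 3 * \<bar>x - z\<bar> \<ge> x + z \<or> sqrt 3 * \<bar>y - z\<bar> \<ge> y + z \<longleftrightarrow>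
    (2 + sqrt 3) * x \<le> z"
proof -
  have "(2 + sqrt 3) * x \<le> (2 + sqrt 3) * y" using assms by (intro mult_left_mono) auto
  moreover have "x \<le> z" using assms by simp
  ultimately show ?thesis
    using assms unfolding sqrt3_ratio_iff[OF assms(2)] sqrt3_ratio_iff[OF assms(3)]
      sqrt3_ratio_iff[OF \<open>x \<le> z\<close>]
    by (meson order_trans)
qed

text \<open>The roots of \<open>t^2 - 4 t + 1\<close> are \<open>2 + sqrt 3\<close> and
  \<open>2 - sqrt 3\<close>; the second is below 1, so \<open>x \<le> z\<close> fixes the sign of
  its factor.\<close>

lemma four_product_le_sum_squares_iff:
  fixes x z :: real
  assumes "0 \<le> x" "x \<le> z"
  shows "4 * (x * z) \<le> x\<^sup>2 + z\<^sup>2 \<longleftrightarrow> (2 + sqrt 3) * x \<le> z"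
proof -
  have factor: "x\<^sup>2 + z\<^sup>2 - 4 * (x * z) = (z - (2 + k) * x) * (z - (2 - k) * x)"
    if "k * k = 3" for k :: real
  proof -
    have "k * (k * (x * x)) = 3 * (x * x)" using that by (metis mult.assoc)
    then show ?thesis by (simp add: algebra_simps power2_eq_square)
  qed
  have "4 * (x * z) \<le> x\<^sup>2 + z\<^sup>2 \<longleftrightarrow> x\<^sup>2 + z\<^sup>2 - 4 * (x * z) \<ge> 0" by simp
  also have "x\<^sup>2 + z\<^sup>2 - 4 * (x * z) = (z - (2 + sqrt 3) * x) * (z - (2 - sqrt 3) * x)"
    by (rule factor) simp
  also have "\<dots> \<ge> 0 \<longleftrightarrow> (2 + sqrt 3) * x \<le> z"
  proof (cases "x = 0")
    case False
    with assms have "(2 - sqrt 3) * x < 1 * x" by (intro mult_strict_right_mono) auto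
    then have "z - (2 - sqrt 3) * x > 0" using assms by simp
    then show ?thesis by (simp add: zero_le_mult_iff)
  qed (use assms in simp)
  finally show ?thesis .
qed

text \<open>
  The Laplacian compressed to the span of \<open>(1, 1, 1, -3)\<close> and \<open>(1, 1, -2, 0)\<close> has trace
  \<open>2 f + 3 u / 2\<close> and determinant \<open>2 f u\<close> with \<open>u = b + d\<close>. Its eigenvalues \<open>\<mu> \<le> \<nu>\<close> have
  \<open>\<mu> \<le> 4 f / 3 \<le> \<nu>\<close>, so the characteristic polynomial has the signs at \<open>\<mu>\<close> and \<open>\<nu>\<close>
  that Cauchy interlacing predicts, and AM-GM bounds \<open>\<nu> / \<mu>\<close> from below.
\<close>
lemma kite_ratio:
  fixes x y z :: real
  assumes coeffs: "laplacian_coeffs a b 0 d 0 f x y z"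
    and nonneg: "a \<ge> 0" "b \<ge> 0" "d \<ge> 0" "f \<ge> 0"
    and sorted: "x \<le> y" "y \<le> z"
  shows "(2 + sqrt 3) * x \<le> z"
proof -
  define u where "u = b + d"
  have u: "u \<ge> 0" using nonneg by (simp add: u_def)
  have "4 * (2 * f * u) \<le> (2 * f + 3 / 2 * u)\<^sup>2"
  proof -
    have "(2 * f + 3 / 2 * u)\<^sup>2 - 4 * (2 * f * u) = (2 * f - 3 / 2 * u)\<^sup>2 + 4 * f * u"
      by (simp add: field_simps power2_eq_square)
    moreover have "\<dots> \<ge> 0" using nonneg u by simp
    ultimately show ?thesis by simp
  qed
  then obtain \<mu> \<nu> where \<mu>\<nu>: "0 \<le> \<mu>" "\<mu> \<le> \<nu>" "\<mu> + \<nu> = 2 * f + 3 / 2 * u" "\<mu> * \<nu> = 2 * f * u"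
    using nonneg_quadratic_roots[of "2 * f + 3 / 2 * u" "2 * f * u"] nonneg u by auto
  have "(4 * f - 3 * \<mu>) * (4 * f - 3 * \<nu>) = - 8 * f\<^sup>2"
    using \<mu>\<nu>(3,4) by (simp add: field_simps) Groebner_Basis.algebra
  also have "\<dots> \<le> 0" by simp
  finally have between: "3 * \<mu> \<le> 4 * f" "4 * f \<le> 3 * \<nu>"
    using \<mu>\<nu>(2) by (auto simp: mult_le_0_iff)
  \<comment> \<open>This is the remainder of the cubic with roots \<open>x\<close>,
    \<open>y\<close>, \<open>z\<close> modulo the polynomial of the compression;
    \<open>b - d\<close> measures the coupling to \<open>(1, -1, 0, 0)\<close>.\<close>
  have char: "4 * ((t - x) * (t - y) * (t - z)) = (b - d)\<^sup>2 * (4 * f - 3 * t)"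
    if "t\<^sup>2 - (2 * f + 3 / 2 * u) * t + 2 * f * u = 0" for t
  proof -
    have "x + y + z = 2 * (a + b + d + f)"
      "x * y + x * z + y * z = 3 * (a*b + a*d + b*d + b*f + d*f) + 4 * (a*f)"
      "x * y * z = 4 * (a*b*f + a*d*f + b*d*f)"
      using coeffs by (simp_all add: laplacian_coeffs_def)
    moreover have "2 * t\<^sup>2 - (4 * f + 3 * (b + d)) * t + 4 * f * (b + d) = 0"
      using that by (simp add: u_def field_simps)
    ultimately show ?thesis by Groebner_Basis.algebra
  qed
  have "x \<le> \<mu>"
  proof (rule ccontr)
    assume "\<not> x \<le> \<mu>"
    then have "(\<mu> - x) * (\<mu> - y) * (\<mu> - z) < 0"
      using sorted by (intro mult_pos_neg mult_neg_neg) auto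
    moreover have "\<mu>\<^sup>2 - (2 * f + 3 / 2 * u) * \<mu> + 2 * f * u = 0"
      unfolding \<mu>\<nu>(3,4)[symmetric] by Groebner_Basis.algebra
    then have "4 * ((\<mu> - x) * (\<mu> - y) * (\<mu> - z)) \<ge> 0"
      using between by (simp add: char)
    ultimately show False by simp
  qed
  have "\<nu> \<le> z"
  proof (rule ccontr)
    assume "\<not> \<nu> \<le> z"
    then have "(\<nu> - x) * (\<nu> - y) * (\<nu> - z) > 0"
      using sorted by (intro mult_pos_pos) auto
    moreover have "\<nu>\<^sup>2 - (2 * f + 3 / 2 * u) * \<nu> + 2 * f * u = 0"
      unfolding \<mu>\<nu>(3,4)[symmetric] by Groebner_Basis.algebra
    then have "4 * ((\<nu> - x) * (\<nu> - y) * (\<nu> - z)) \<le> 0"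
      using between by (simp add: char mult_nonneg_nonpos)
    ultimately show False by simp
  qed
  \<comment> \<open>AM-GM for \<open>2 f\<close> and \<open>3 u / 2\<close>: four times their
    product is \<open>6 \<mu> \<nu>\<close>.\<close>
  have "\<mu>\<^sup>2 + \<nu>\<^sup>2 - 4 * (\<mu> * \<nu>) = (2 * f - 3 / 2 * u)\<^sup>2"
  proof -
    have "\<mu>\<^sup>2 + \<nu>\<^sup>2 - 4 * (\<mu> * \<nu>) = (\<mu> + \<nu>)\<^sup>2 - 6 * (\<mu> * \<nu>)" by Groebner_Basis.algebra
    then show ?thesis unfolding \<mu>\<nu>(3,4) by (simp add: field_simps power2_eq_square)
  qed
  then have "4 * (\<mu> * \<nu>) \<le> \<mu>\<^sup>2 + \<nu>\<^sup>2" by (metis diff_ge_0_iff_ge zero_le_power2)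
  then have "(2 + sqrt 3) * \<mu> \<le> \<nu>" by (simp only: four_product_le_sum_squares_iff[OF \<mu>\<nu>(1,2)])
  moreover have "(2 + sqrt 3) * x \<le> (2 + sqrt 3) * \<mu>" using \<open>x \<le> \<mu>\<close> by (intro mult_left_mono) auto
  ultimately show ?thesis using \<open>\<nu> \<le> z\<close> by linarith
qed

text \<open>
  With \<open>b = d\<close> the vector \<open>(1, -1, 0, 0)\<close> is an eigenvector, and \<open>x, z\<close> are the eigenvalues of the
  compression above: \<open>2 f\<close> and \<open>3 u / 2\<close> have sum \<open>x + z\<close> and product \<open>3 x z / 2\<close>. Taking the
  smaller one for \<open>3 u / 2\<close> keeps \<open>a\<close> nonnegative.
\<close>
lemma realizable_kite_sorted:
  assumes "0 \<le> x" "x \<le> y" "y \<le> z" "(2 + sqrt 3) * x \<le> z"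
  shows "realizable kite_graph (x, y, z)"
proof -
  have "4 * (x * z) \<le> x\<^sup>2 + z\<^sup>2" using assms by (simp add: four_product_le_sum_squares_iff)
  then have "4 * (3 / 2 * (x * z)) \<le> (x + z)\<^sup>2" by (simp add: power2_sum)
  then obtain r s where rs: "0 \<le> r" "r \<le> s" "r + s = x + z" "r * s = 3 / 2 * (x * z)"
    using nonneg_quadratic_roots[of "x + z" "3 / 2 * (x * z)"] assms by auto
  \<comment> \<open>This makes the weight \<open>y / 2 - r / 6\<close> of edge 12 nonnegative. In
    fact \<open>r \<le> 3 x\<close> when \<open>z > 0\<close>, because
    \<open>2 s \<ge> r + s \<ge> z\<close>.\<close>
  have "r \<le> 3 * y"
  proof (cases "z = 0")
    case False
    with assms have "z > 0" by simp
    moreover have "z \<le> 2 * s" using rs assms by linarith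
    then have "r * z \<le> r * (2 * s)" using rs by (intro mult_left_mono)
    then have "r * z \<le> 3 * x * z" using rs(4) by simp
    ultimately show ?thesis using assms by simp
  qed (use rs assms in auto)
  define v where "v = r / 6"
  have "laplacian_coeffs (y / 2 - v) (2 * v) 0 (2 * v) 0 (s / 2) x y z"
  proof -
    have "6 * v + s = x + z" "4 * (v * s) = x * z" using rs(3,4) by (simp_all add: v_def)
    then show ?thesis
      unfolding laplacian_coeffs_def by (intro conjI; simp add: field_simps; Groebner_Basis.algebra)
  qed
  then show ?thesis
    by (rule realizableI) (use rs \<open>r \<le> 3 * y\<close> in \<open>auto simp: kite_graph_def v_def\<close>)
qed

subsection \<open>Path\<close>

text \<open>
  Given its middle weight \<open>b\<close>, a path is determined up to symmetry by \<open>p = a + c\<close> and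
  \<open>m = a c\<close>, where \<open>a\<close> and \<open>c\<close> are the outer weights. With \<open>s\<close> half the trace, the first two
  coefficients give \<open>p = s - b\<close> and \<open>4 m = e2 - 3 b (s - b)\<close>; the third one becomes the cubic
  equation below, and \<open>4 m \<le> p\<^sup>2\<close> becomes the quadratic inequality.
\<close>
lemma path_middle_weight:
  fixes s e2 e3 b :: real
  assumes "s \<ge> 0" "e2 \<ge> 0" "e3 \<ge> 0" "e3 \<le> s * e2"
    and cubic: "3 * b ^ 3 - 3 * s * b\<^sup>2 + e2 * b - e3 = 0"
    and quadratic: "2 * b\<^sup>2 - s * b + e2 - s\<^sup>2 \<le> 0"
  obtains a c where "a \<ge> 0" "b \<ge> 0" "c \<ge> 0" "a + b + c = s"
    "3 * (a * b + b * c) + 4 * (a * c) = e2" "4 * (a * b * c) = e3"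
proof -
  define m where "m = (e2 - 3 * b * (s - b)) / 4"
  have m: "4 * m = e2 - 3 * b * (s - b)" by (simp add: m_def)
  have mb: "4 * m * b = e3" using m cubic by Groebner_Basis.algebra
  have b: "b \<ge> 0"
  proof (rule ccontr)
    assume "\<not> b \<ge> 0"
    then have "b ^ 3 < 0" "e2 * b \<le> 0" "3 * s * b\<^sup>2 \<ge> 0"
      using assms by (simp_all add: power_less_zero_eq mult_nonneg_nonpos)
    \<comment> \<open>For negative \<open>b\<close> every term of the cubic is nonpositive and the
      first is negative.\<close>
    with cubic assms show False by linarith
  qed
  have "b \<le> s"
  proof (rule ccontr)
    assume "\<not> b \<le> s"
    \<comment> \<open>Beyond \<open>s\<close> the cubic stays positive because
      \<open>e3 \<le> s * e2\<close>.\<close>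
    then have "3 * b\<^sup>2 * (b - s) > 0" "e2 * b \<ge> e2 * s"
      using assms by (auto intro!: mult_pos_pos mult_left_mono)
    moreover have "3 * b\<^sup>2 * (b - s) + e2 * b = e3" using cubic by Groebner_Basis.algebra
    moreover have "e2 * s = s * e2" by simp
    ultimately show False using assms by linarith
  qed
  moreover have "m \<ge> 0"
  proof (cases "b = 0")
    case False
    with b have "b > 0" by simp
    moreover have "m * b \<ge> 0" using mb assms by simp
    ultimately show ?thesis by (simp add: zero_le_mult_iff)
  qed (use m assms in simp)
  moreover have "(s - b)\<^sup>2 - 4 * m = - (2 * b\<^sup>2 - s * b + e2 - s\<^sup>2)"
    unfolding m by Groebner_Basis.algebra
  then have "4 * m \<le> (s - b)\<^sup>2" using quadratic by simp
  ultimately obtain a c where ac: "0 \<le> a" "a \<le> c" "a + c = s - b" "a * c = m"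
    using nonneg_quadratic_roots[of "s - b" m] by auto
  show thesis
  proof
    show "a + b + c = s" using ac by simp
    show "3 * (a * b + b * c) + 4 * (a * c) = e2" using ac(3,4) m by Groebner_Basis.algebra
    show "4 * (a * b * c) = e3" using mb unfolding ac(4)[symmetric] by (simp add: mult_ac)
  qed (use ac b in simp_all)
qed

text \<open>
  Modulo the quadratic, the cubic is \<open>\<alpha> b + \<beta>\<close>; the hypothesis says that this linear function
  changes sign between the two roots \<open>(s \<plusminus> \<surd>D) / 4\<close> of the quadratic.
\<close>
lemma cubic_root_in_quadratic_interval:
  fixes s e2 e3 :: real
  defines "D \<equiv> 9 * s\<^sup>2 - 8 * e2" and "\<alpha> \<equiv> 3 / 4 * s\<^sup>2 - e2 / 2"
    and "\<beta> \<equiv> 3 / 4 * s * (e2 - s\<^sup>2) - e3"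
  assumes D: "D \<ge> 0" and \<alpha>: "\<alpha> \<ge> 0" and le: "(\<alpha> * s + 4 * \<beta>)\<^sup>2 \<le> \<alpha>\<^sup>2 * D"
  obtains b where "3 * b ^ 3 - 3 * s * b\<^sup>2 + e2 * b - e3 = 0" "2 * b\<^sup>2 - s * b + e2 - s\<^sup>2 \<le> 0"
proof -
  define h q where "h b = 3 * b ^ 3 - 3 * s * b\<^sup>2 + e2 * b - e3"
    and "q b = 2 * b\<^sup>2 - s * b + e2 - s\<^sup>2" for b
  define R lo hi where "R = sqrt D" and "lo = (s - R) / 4" and "hi = (s + R) / 4"
  have R: "R \<ge> 0" "R\<^sup>2 = 9 * s\<^sup>2 - 8 * e2" using D by (simp_all add: R_def D_def)
  have q: "q b = 2 * (b - lo) * (b - hi)" for b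
    using R(2) by (simp add: q_def lo_def hi_def field_simps power2_eq_square)
  \<comment> \<open>Division with remainder; at the roots \<open>lo\<close> and \<open>hi\<close> of
    \<open>q\<close> only the linear remainder survives.\<close>
  have h: "h b = (3 / 2 * b - 3 / 4 * s) * q b + \<alpha> * b + \<beta>" for b
    by (simp add: h_def q_def \<alpha>_def \<beta>_def field_simps power2_eq_square power3_eq_cube)
  have "(\<alpha> * s + 4 * \<beta>)\<^sup>2 \<le> (\<alpha> * R)\<^sup>2" using le R D_def by (simp add: power_mult_distrib)
  then have "\<bar>\<alpha> * s + 4 * \<beta>\<bar> \<le> \<alpha> * R"
    using \<alpha> R(1) by (simp add: abs_le_square_iff[symmetric] abs_mult)
  moreover have "4 * (\<alpha> * lo + \<beta>) = \<alpha> * s + 4 * \<beta> - \<alpha> * R"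
    and "4 * (\<alpha> * hi + \<beta>) = \<alpha> * s + 4 * \<beta> + \<alpha> * R"
    by (simp_all add: lo_def hi_def field_simps)
  ultimately have "4 * (\<alpha> * lo + \<beta>) \<le> 0" "4 * (\<alpha> * hi + \<beta>) \<ge> 0" by (simp_all add: abs_le_iff)
  then have "\<alpha> * lo + \<beta> \<le> 0" "\<alpha> * hi + \<beta> \<ge> 0" by simp_all
  then have "h lo \<le> 0" "h hi \<ge> 0" by (simp_all add: h q)
  then have "\<exists>b\<ge>lo. b \<le> hi \<and> h b = 0"
    using R(1) by (intro IVT') (auto simp: h_def lo_def hi_def intro!: continuous_intros)
  then obtain b where b: "lo \<le> b" "b \<le> hi" "h b = 0" by blast
  then have "q b \<le> 0" by (simp add: q mult_nonneg_nonpos)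
  with b(3) show thesis using that by (simp add: h_def q_def)
qed

text \<open>
  The left-hand side is the resultant of the cubic and the quadratic up to a constant; in the
  weights of a path it becomes visibly nonnegative.
\<close>
lemma path_identity:
  fixes s e2 e3 a b c :: real
  assumes "s = a + b + c" "e2 = 3 * (a * b + b * c) + 4 * (a * c)" "e3 = 4 * (a * b * c)"
  shows "(6 * s\<^sup>2 - 4 * e2)\<^sup>2 * (9 * s\<^sup>2 - 8 * e2) - (18 * s ^ 3 - 20 * s * e2 + 32 * e3)\<^sup>2 =
    32 * (a - c)\<^sup>2 * ((8 * (a * c) - 3 * b * (a + b + c))\<^sup>2 + 27 * (b * (a + c - b))\<^sup>2)"
proof -
  define p m where "p = a + c" and "m = a * c"
  have sym: "s = p + b" "e2 = 3 * b * p + 4 * m" "e3 = 4 * b * m" "(a - c)\<^sup>2 = p\<^sup>2 - 4 * m"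
    using assms by (simp_all add: p_def m_def algebra_simps power2_eq_square)
  have "6 * s\<^sup>2 - 4 * e2 = 6 * p\<^sup>2 + 6 * b\<^sup>2 - 16 * m"
    "9 * s\<^sup>2 - 8 * e2 = 9 * p\<^sup>2 - 6 * p * b + 9 * b\<^sup>2 - 32 * m"
    "18 * s ^ 3 - 20 * s * e2 + 32 * e3 =
      18 * p ^ 3 - 6 * p\<^sup>2 * b - 6 * p * b\<^sup>2 + 18 * b ^ 3 - 80 * p * m + 48 * b * m"
    by (simp_all add: sym algebra_simps power2_eq_square power3_eq_cube)
  moreover have "a + b + c = b + p" "a + c - b = p - b" "a * c = m" by (simp_all add: p_def m_def)
  ultimately show ?thesis
    by (simp only: sym(4)) (simp add: algebra_simps power2_eq_square power3_eq_cube)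
qed

subsection \<open>Realizable triples\<close>

theorem theorem1:
  shows
    "(\<forall>x y z :: real. realizable star_graph (x, y, z) \<longleftrightarrow>
        x \<ge> 0 \<and> y \<ge> 0 \<and> z \<ge> 0 \<and>
        (6 * x\<^sup>2 - 2 * x * y - 2 * x * z + y * z) *
        (6 * y\<^sup>2 - 2 * x * y - 2 * y * z + x * z) *
        (6 * z\<^sup>2 - 2 * x * z - 2 * y * z + x * y) \<le> 0)
     \<and>
     (\<forall>x y z :: real. realizable cycle_graph (x, y, z) \<longleftrightarrow>
        x \<ge> 0 \<and> y \<ge> 0 \<and> z \<ge> 0 \<and> Max {x, y, z} \<ge> 1 / 2 * (x + y + z))
     \<and>
     (\<forall>x y z :: real. realizable path_graph (x, y, z) \<longleftrightarrow>
        x \<ge> 0 \<and> y \<ge> 0 \<and> z \<ge> 0 \<and> Max {x, y, z} \<ge> 1 / 2 * (x + y + z) \<and>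
        (let S = x\<^sup>2 + y\<^sup>2 + z\<^sup>2;
             P = x * y + x * z + y * z;
             U = x\<^sup>2 * (y + z) + y\<^sup>2 * (x + z) + z\<^sup>2 * (x + y)
         in (9 * (x ^ 3 + y ^ 3 + z ^ 3) - 13 * U + 62 * x * y * z)\<^sup>2
              \<le> (3 * S - 2 * P)\<^sup>2 * (9 * S - 14 * P)))
     \<and>
     (\<forall>x y z :: real. realizable kite_graph (x, y, z) \<longleftrightarrow>
        x \<ge> 0 \<and> y \<ge> 0 \<and> z \<ge> 0 \<and>
        (sqrt 3 * \<bar>x - y\<bar> \<ge> x + y \<or>
         sqrt 3 * \<bar>x - z\<bar> \<ge> x + z \<or>
         sqrt 3 * \<bar>y - z\<bar> \<ge> y + z))
     \<and>
     (\<forall>x y z :: real. realizable complete_graph (x, y, z) \<longleftrightarrow>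
        x \<ge> 0 \<and> y \<ge> 0 \<and> z \<ge> 0)"
proof -
  have star:
    "realizable star_graph (x, y, z) \<longleftrightarrow> x \<ge> 0 \<and> y \<ge> 0 \<and> z \<ge> 0 \<and>
      (6 * x\<^sup>2 - 2 * x * y - 2 * x * z + y * z) *
      (6 * y\<^sup>2 - 2 * x * y - 2 * y * z + x * z) *
      (6 * z\<^sup>2 - 2 * x * z - 2 * y * z + x * y) \<le> 0" for x y z :: real
  proof -
    \<comment> \<open>The values that the elementary symmetric functions of the three star weights
      must take.\<close>
    define p q r where "p = (x + y + z) / 2" and "q = (x * y + x * z + y * z) / 3"
      and "r = x * y * z / 4"
    have disc: "(6 * x\<^sup>2 - 2 * x * y - 2 * x * z + y * z) *
      (6 * y\<^sup>2 - 2 * x * y - 2 * y * z + x * z) *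
      (6 * z\<^sup>2 - 2 * x * z - 2 * y * z + x * y) =
      - 432 * (p\<^sup>2 * q\<^sup>2 - 4 * q ^ 3 - 4 * p ^ 3 * r + 18 * p * q * r - 27 * r\<^sup>2)"
    proof -
      have "x + y + z = 2 * p" "x * y + x * z + y * z = 3 * q" "x * y * z = 4 * r"
        by (simp_all add: p_def q_def r_def)
      then show ?thesis by Groebner_Basis.algebra
    qed
    have "realizable star_graph (x, y, z) \<longleftrightarrow>
      (\<exists>a\<ge>0. \<exists>b\<ge>0. \<exists>c\<ge>0. laplacian_coeffs 0 0 a 0 b c x y z)"
    proof
      assume "realizable star_graph (x, y, z)"
      then show "\<exists>a\<ge>0. \<exists>b\<ge>0. \<exists>c\<ge>0. laplacian_coeffs 0 0 a 0 b c x y z"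
        by (rule realizableE) (auto simp: star_graph_def doubleton_eq_iff)
    next
      assume "\<exists>a\<ge>0. \<exists>b\<ge>0. \<exists>c\<ge>0. laplacian_coeffs 0 0 a 0 b c x y z"
      then show "realizable star_graph (x, y, z)"
        by (elim exE conjE, elim realizableI) (auto simp: star_graph_def)
    qed
    also have "\<dots> \<longleftrightarrow>
      (\<exists>a\<ge>0. \<exists>b\<ge>0. \<exists>c\<ge>0. a + b + c = p \<and> a * b + a * c + b * c = q \<and> a * b * c = r)"
    proof -
      have "laplacian_coeffs 0 0 a 0 b c x y z \<longleftrightarrow>
        a + b + c = p \<and> a * b + a * c + b * c = q \<and> a * b * c = r" for a b c
        unfolding laplacian_coeffs_def p_def q_def r_def by auto
      then show ?thesis by simp
    qed
    also have "\<dots> \<longleftrightarrow> x \<ge> 0 \<and> y \<ge> 0 \<and> z \<ge> 0 \<and>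
      p\<^sup>2 * q\<^sup>2 - 4 * q ^ 3 - 4 * p ^ 3 * r + 18 * p * q * r - 27 * r\<^sup>2 \<ge> 0" (is "?L \<longleftrightarrow> ?R")
    proof
      assume ?L
      then obtain a b c where abc: "a \<ge> 0" "b \<ge> 0" "c \<ge> 0"
        "p = a + b + c" "q = a * b + a * c + b * c" "r = a * b * c" by metis
      have "laplacian_coeffs 0 0 a 0 b c x y z"
        using abc(4-) by (simp add: laplacian_coeffs_def p_def q_def r_def field_simps)
      from laplacian_coeffs_nonneg[OF this] abc cubic_discriminant_roots[OF abc(4-)] show ?R by simp
    next
      assume ?R
      moreover from this have "p \<ge> 0" "q \<ge> 0" "r \<ge> 0" by (simp_all add: p_def q_def r_def)
      ultimately obtain a b c where "a \<ge> 0" "b \<ge> 0" "c \<ge> 0"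
        "a + b + c = p" "a * b + a * c + b * c = q" "a * b * c = r"
        using nonneg_cubic_roots[of p q r] by auto
      then show ?L by blast
    qed
    also have "p\<^sup>2 * q\<^sup>2 - 4 * q ^ 3 - 4 * p ^ 3 * r + 18 * p * q * r - 27 * r\<^sup>2 \<ge> 0 \<longleftrightarrow>
      (6 * x\<^sup>2 - 2 * x * y - 2 * x * z + y * z) *
      (6 * y\<^sup>2 - 2 * x * y - 2 * y * z + x * z) *
      (6 * z\<^sup>2 - 2 * x * z - 2 * y * z + x * y) \<le> 0"
      unfolding disc mult_le_0_iff by simp
    finally show ?thesis .
  qed
  have cycle:
    "realizable cycle_graph (x, y, z) \<longleftrightarrow>
      x \<ge> 0 \<and> y \<ge> 0 \<and> z \<ge> 0 \<and> Max {x, y, z} \<ge> 1 / 2 * (x + y + z)"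
    for x y z :: real
  proof (induction x y z rule: sorted_triple_wlog)
    case (3 x y z)
    show ?case
    proof
      assume "realizable cycle_graph (x, y, z)"
      then obtain a c d f where "laplacian_coeffs a 0 c d 0 f x y z" "a \<ge> 0" "c \<ge> 0" "d \<ge> 0" "f \<ge> 0"
        by (rule realizableE) (auto simp: cycle_graph_def doubleton_eq_iff)
      from cycle_max_condition[OF this] laplacian_coeffs_nonneg[OF this(1)] this
      show "x \<ge> 0 \<and> y \<ge> 0 \<and> z \<ge> 0 \<and> Max {x, y, z} \<ge> 1 / 2 * (x + y + z)"
        by (simp del: Max_insert)
    next
      assume "x \<ge> 0 \<and> y \<ge> 0 \<and> z \<ge> 0 \<and> Max {x, y, z} \<ge> 1 / 2 * (x + y + z)"
      \<comment> \<open>For a sorted triple the maximum condition reads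
        \<open>x + y \<le> z\<close>.\<close>
      with 3 show "realizable cycle_graph (x, y, z)"
        by (intro realizable_cycle_sorted) (auto simp: max_def split: if_splits)
    qed
  next
    case (1 x y z)
    then show ?case
      unfolding realizable_swap12[of _ y x z] by (auto simp: insert_commute add.commute)
  next
    case (2 x y z)
    then show ?case
      unfolding realizable_swap23[of _ x z y] by (auto simp: insert_commute ac_simps)
  qed
  have path:
    "realizable path_graph (x, y, z) \<longleftrightarrow>
      x \<ge> 0 \<and> y \<ge> 0 \<and> z \<ge> 0 \<and> Max {x, y, z} \<ge> 1 / 2 * (x + y + z) \<and>
      (9 * (x ^ 3 + y ^ 3 + z ^ 3) - 13 * (x\<^sup>2 * (y + z) + y\<^sup>2 * (x + z) + z\<^sup>2 * (x + y))
        + 62 * x * y * z)\<^sup>2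
      \<le> (3 * (x\<^sup>2 + y\<^sup>2 + z\<^sup>2) - 2 * (x * y + x * z + y * z))\<^sup>2 *
        (9 * (x\<^sup>2 + y\<^sup>2 + z\<^sup>2) - 14 * (x * y + x * z + y * z))" for x y z :: real
  proof -
    define S P U where "S = x\<^sup>2 + y\<^sup>2 + z\<^sup>2" and "P = x * y + x * z + y * z"
      and "U = x\<^sup>2 * (y + z) + y\<^sup>2 * (x + z) + z\<^sup>2 * (x + y)"
    let ?N = "9 * (x ^ 3 + y ^ 3 + z ^ 3) - 13 * U + 62 * x * y * z"
    define s e3 where "s = (x + y + z) / 2" and "e3 = x * y * z"
    have N: "?N = 4 * (18 * s ^ 3 - 20 * s * P + 32 * e3)"
      and S: "3 * S - 2 * P = 2 * (6 * s\<^sup>2 - 4 * P)" "9 * S - 14 * P = 4 * (9 * s\<^sup>2 - 8 * P)"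
      unfolding s_def e3_def S_def P_def U_def
      by (simp_all add: field_simps power2_eq_square power3_eq_cube)
    \<comment> \<open>In terms of \<open>s\<close>, \<open>P\<close> and \<open>e3\<close> both
      sides share the factor 16; what remains is the inequality given by
      \<open>path_identity\<close>.\<close>
    have cond: "?N\<^sup>2 \<le> (3 * S - 2 * P)\<^sup>2 * (9 * S - 14 * P) \<longleftrightarrow>
      (18 * s ^ 3 - 20 * s * P + 32 * e3)\<^sup>2 \<le> (6 * s\<^sup>2 - 4 * P)\<^sup>2 * (9 * s\<^sup>2 - 8 * P)"
    proof -
      have "(4 * A)\<^sup>2 \<le> (2 * B)\<^sup>2 * (4 * C) \<longleftrightarrow> A\<^sup>2 \<le> B\<^sup>2 * C" for A B C :: real
        by (simp add: power_mult_distrib)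
      then show ?thesis unfolding N S .
    qed
    have coeffs_iff: "laplacian_coeffs a 0 0 b 0 c x y z \<longleftrightarrow>
      s = a + b + c \<and> P = 3 * (a * b + b * c) + 4 * (a * c) \<and> e3 = 4 * (a * b * c)" for a b c
      unfolding laplacian_coeffs_def s_def P_def e3_def by (auto simp: algebra_simps)
    show ?thesis unfolding S_def[symmetric] P_def[symmetric] U_def[symmetric] cond
    proof
      assume "realizable path_graph (x, y, z)"
      then obtain a b c where coeffs: "laplacian_coeffs a 0 0 b 0 c x y z"
        and abc: "a \<ge> 0" "b \<ge> 0" "c \<ge> 0"
        by (rule realizableE) (auto simp: path_graph_def doubleton_eq_iff)
      have "32 * (a - c)\<^sup>2 * ((8 * (a * c) - 3 * b * (a + b + c))\<^sup>2 + 27 * (b * (a + c - b))\<^sup>2) \<ge> 0"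
        by simp
      moreover have "s = a + b + c" "P = 3 * (a * b + b * c) + 4 * (a * c)" "e3 = 4 * (a * b * c)"
        using coeffs by (simp_all only: coeffs_iff)
      ultimately have "(18 * s ^ 3 - 20 * s * P + 32 * e3)\<^sup>2 \<le> (6 * s\<^sup>2 - 4 * P)\<^sup>2 * (9 * s\<^sup>2 - 8 * P)"
        by (simp only: path_identity[symmetric] diff_ge_0_iff_ge)
      then show "x \<ge> 0 \<and> y \<ge> 0 \<and> z \<ge> 0 \<and> Max {x, y, z} \<ge> 1 / 2 * (x + y + z) \<and>
        (18 * s ^ 3 - 20 * s * P + 32 * e3)\<^sup>2 \<le> (6 * s\<^sup>2 - 4 * P)\<^sup>2 * (9 * s\<^sup>2 - 8 * P)"
        using cycle_max_condition[OF coeffs] laplacian_coeffs_nonneg[OF coeffs] abc by simp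
    next
      assume "x \<ge> 0 \<and> y \<ge> 0 \<and> z \<ge> 0 \<and> Max {x, y, z} \<ge> 1 / 2 * (x + y + z) \<and>
        (18 * s ^ 3 - 20 * s * P + 32 * e3)\<^sup>2 \<le> (6 * s\<^sup>2 - 4 * P)\<^sup>2 * (9 * s\<^sup>2 - 8 * P)"
      then have xyz: "x \<ge> 0" "y \<ge> 0" "z \<ge> 0"
        and le: "(18 * s ^ 3 - 20 * s * P + 32 * e3)\<^sup>2 \<le> (6 * s\<^sup>2 - 4 * P)\<^sup>2 * (9 * s\<^sup>2 - 8 * P)"
        by simp_all
      show "realizable path_graph (x, y, z)"
      \<comment> \<open>The zero triple is set aside so that \<open>\<alpha>\<close> is strictly
        positive and can be cancelled.\<close>
      proof (cases "x = 0 \<and> y = 0 \<and> z = 0")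
        case True
        then have "laplacian_coeffs 0 0 0 0 0 0 x y z" by (simp add: laplacian_coeffs_def)
        then show ?thesis by (rule realizableI) simp_all
      next
        case False
        define \<alpha> \<beta> where "\<alpha> = 3 / 4 * s\<^sup>2 - P / 2" and "\<beta> = 3 / 4 * s * (P - s\<^sup>2) - e3"
        have "16 * \<alpha> = x\<^sup>2 + y\<^sup>2 + z\<^sup>2 + (x - y)\<^sup>2 + (x - z)\<^sup>2 + (y - z)\<^sup>2"
          by (simp add: \<alpha>_def s_def P_def field_simps power2_eq_square)
        moreover have "x\<^sup>2 > 0 \<or> y\<^sup>2 > 0 \<or> z\<^sup>2 > 0" using False by auto
        then have "x\<^sup>2 + y\<^sup>2 + z\<^sup>2 + (x - y)\<^sup>2 + (x - z)\<^sup>2 + (y - z)\<^sup>2 > 0"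
          by (elim disjE) (simp_all add: add_pos_nonneg add_nonneg_pos)
        ultimately have \<alpha>: "\<alpha> > 0" by simp
        have eq: "6 * s\<^sup>2 - 4 * P = 8 * \<alpha>" "18 * s ^ 3 - 20 * s * P + 32 * e3 = - 8 * (\<alpha> * s + 4 * \<beta>)"
          by (simp_all add: \<alpha>_def \<beta>_def field_simps power2_eq_square power3_eq_cube)
        have le': "(\<alpha> * s + 4 * \<beta>)\<^sup>2 \<le> \<alpha>\<^sup>2 * (9 * s\<^sup>2 - 8 * P)"
        proof -
          have "(- 8 * A)\<^sup>2 \<le> (8 * B)\<^sup>2 * C \<longleftrightarrow> A\<^sup>2 \<le> B\<^sup>2 * C" for A B C :: real
            by (simp add: power_mult_distrib)
          then show ?thesis using le unfolding eq by blast
        qed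
        then have "\<alpha>\<^sup>2 * (9 * s\<^sup>2 - 8 * P) \<ge> 0" using zero_le_power2 order_trans by blast
        then have "9 * s\<^sup>2 - 8 * P \<ge> 0" using \<alpha> by (simp add: zero_le_mult_iff)
        then obtain b where b: "3 * b ^ 3 - 3 * s * b\<^sup>2 + P * b - e3 = 0"
          "2 * b\<^sup>2 - s * b + P - s\<^sup>2 \<le> 0"
          using cubic_root_in_quadratic_interval[of s P e3] \<alpha> le' unfolding \<alpha>_def \<beta>_def by auto
        have "s \<ge> 0" "P \<ge> 0" "e3 \<ge> 0" using xyz by (simp_all add: s_def P_def e3_def)
        moreover have "e3 \<le> s * P"
        proof -
          \<comment> \<open>Expansion of \<open>(x + y + z) * (x y + x z + y z)\<close>, in which
            \<open>x y z\<close> occurs three times.\<close>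
          have "2 * (s * P) = 3 * e3 + (x\<^sup>2 * (y + z) + y\<^sup>2 * (x + z) + z\<^sup>2 * (x + y))"
            by (simp add: s_def P_def e3_def field_simps power2_eq_square)
          moreover have "x\<^sup>2 * (y + z) + y\<^sup>2 * (x + z) + z\<^sup>2 * (x + y) \<ge> 0" using xyz by simp
          ultimately show ?thesis using \<open>e3 \<ge> 0\<close> by linarith
        qed
        ultimately obtain a c where ac: "a \<ge> 0" "b \<ge> 0" "c \<ge> 0" "a + b + c = s"
          "3 * (a * b + b * c) + 4 * (a * c) = P" "4 * (a * b * c) = e3"
          by (rule path_middle_weight[OF _ _ _ _ b])
        then have "laplacian_coeffs a 0 0 b 0 c x y z" unfolding coeffs_iff by simp
        then show ?thesis
          by (rule realizableI) (use ac in \<open>auto simp: path_graph_def\<close>)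
      qed
    qed
  qed
  have kite:
    "realizable kite_graph (x, y, z) \<longleftrightarrow> x \<ge> 0 \<and> y \<ge> 0 \<and> z \<ge> 0 \<and>
      (sqrt 3 * \<bar>x - y\<bar> \<ge> x + y \<or> sqrt 3 * \<bar>x - z\<bar> \<ge> x + z \<or> sqrt 3 * \<bar>y - z\<bar> \<ge> y + z)"
    for x y z :: real
  proof (induction x y z rule: sorted_triple_wlog)
    case (1 x y z)
    then show ?case
      unfolding realizable_swap12[of _ y x z] by (auto simp: abs_minus_commute add.commute)
  next
    case (2 x y z)
    then show ?case
      unfolding realizable_swap23[of _ x z y] by (auto simp: abs_minus_commute add.commute)
  next
    case (3 x y z)
    show ?case
    proof
      assume "realizable kite_graph (x, y, z)"
      then obtain a b d f where *: "laplacian_coeffs a b 0 d 0 f x y z"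
        "a \<ge> 0" "b \<ge> 0" "d \<ge> 0" "f \<ge> 0"
        by (rule realizableE) (auto simp: kite_graph_def doubleton_eq_iff)
      have nonneg: "x \<ge> 0 \<and> y \<ge> 0 \<and> z \<ge> 0" using laplacian_coeffs_nonneg[OF *(1)] * by simp
      with kite_ratio[OF * 3] 3 show "x \<ge> 0 \<and> y \<ge> 0 \<and> z \<ge> 0 \<and>
        (sqrt 3 * \<bar>x - y\<bar> \<ge> x + y \<or> sqrt 3 * \<bar>x - z\<bar> \<ge> x + z \<or> sqrt 3 * \<bar>y - z\<bar> \<ge> y + z)"
        by (simp only: kite_condition_sorted)
    next
      assume "x \<ge> 0 \<and> y \<ge> 0 \<and> z \<ge> 0 \<and>
        (sqrt 3 * \<bar>x - y\<bar> \<ge> x + y \<or> sqrt 3 * \<bar>x - z\<bar> \<ge> x + z \<or> sqrt 3 * \<bar>y - z\<bar> \<ge> y + z)"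
      with 3 kite_condition_sorted[of x y z] show "realizable kite_graph (x, y, z)"
        by (intro realizable_kite_sorted) blast+
    qed
  qed
  have complete:
    "realizable complete_graph (x, y, z) \<longleftrightarrow> x \<ge> 0 \<and> y \<ge> 0 \<and> z \<ge> 0" for x y z :: real
  proof (induction x y z rule: sorted_triple_wlog)
    case (3 x y z)
    show ?case
    proof
      assume "realizable complete_graph (x, y, z)"
      then show "x \<ge> 0 \<and> y \<ge> 0 \<and> z \<ge> 0"
        by (rule realizableE) (simp add: laplacian_coeffs_nonneg)
    next
      assume nonneg: "x \<ge> 0 \<and> y \<ge> 0 \<and> z \<ge> 0"
      \<comment> \<open>Eigenvectors \<open>(1, 1, 1, -3)\<close>, \<open>(1, 1, -2, 0)\<close>, \<open>(1, -1, 0, 0)\<close> for \<open>x, y, z\<close>.\<close>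
      let ?a = "z/2 - y/6 - x/12" and ?b = "y/3 - x/12" and ?c = "x/4"
      have "laplacian_coeffs ?a ?b ?c ?b ?c ?c x y z"
        unfolding laplacian_coeffs_def by (intro conjI; simp add: field_simps)
      moreover have "{i, j} \<in> complete_graph" if "1 \<le> i" "i < j" "j \<le> 4" for i j
        unfolding complete_graph_def using that by blast
      \<comment> \<open>Assigning the eigenvalues in increasing order keeps \<open>?a\<close> and
        \<open>?b\<close> nonnegative.\<close>
      ultimately show "realizable complete_graph (x, y, z)"
        by (elim realizableI) (use 3 nonneg in auto)
    qed
  next
    case (1 x y z)
    then show ?case unfolding realizable_swap12[of _ y x z] by auto
  next
    case (2 x y z)
    then show ?case unfolding realizable_swap23[of _ x z y] by auto
  qed
  show ?thesis
    unfolding Let_def by (intro conjI allI star cycle path kite complete)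
qed

end
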